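(* Let $f \in \partial C_{n,2d}$ be a proper nondegenerate nonnegative circuit polynomial in $n$ variables with inner exponent $\boldsymbol{\beta}$. Then the number of zeros of $f$ in $(\mathbb{R}^* )^n$, where $\mathbb{R}^*=\mathbb{R}\setminus\{0\}$, is $2^n$ if $\boldsymbol{\beta}\in(2\mathbb{N})^n$, and $2^{n-1}$ if $\boldsymbol{\beta}\notin(2\mathbb{N})^n$.
   Context: $\mathbb{N}=\{0,1,2,\dots\}$; $n,d\ge 1$. A lattice point in $\mathbb{N}^n$ is even if it lies in $(2\mathbb{N})^n$. The Newton polytope $\mathrm{New}(f)$ is the convex hull of the exponents of $f$ with nonzero coefficient. A circuit polynomial is a polynomial $f(\mathbf{x})=\sum_{j=0}^r f_{\boldsymbol{\alpha}(j)}\mathbf{x}^{\boldsymbol{\alpha}(j)}+f_{\boldsymbol{\beta}}\mathbf{x}^{\boldsymbol{\beta}}\in\mathbb{R}[x_1,\dots,x_n]$ with $r\le n$, $f_{\boldsymbol{\alpha}(j)}>0$, $f_{\boldsymbol{\beta}}\in\mathbb{R}$, such that $\mathrm{New}(f)$ is a simplex with even vertices $\boldsymbol{\alpha}(0),\dots,\boldsymbol{\alpha}(r)$ and $\boldsymbol{\beta}\in\mathbb{N}^n$ (the inner exponent) is written uniquely as $\boldsymbol{\beta}=\sum_{j=0}^r\lambda_j\boldsymbol{\alpha}(j)$ with $\lambda_j>0$, $\sum_j\lambda_j=1$. Its circuit number is $\Theta_f=\prod_{j=0}^r (f_{\boldsymbol{\alpha}(j)}/\lambda_j)^{\lambda_j}$.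 A sum of monomial squares is a polynomial all of whose terms have positive coefficient and even exponent. A circuit polynomial is proper if it is not a sum of monomial squares. A circuit polynomial is degenerate if it has infinitely many real zeros and its Newton polytope is not $n$-dimensional; otherwise it is nondegenerate. $C_{n,2d}$ is the cone of all finite sums $\sum_i\mu_i f_i$ of degree at most $2d$ with $\mu_i\ge 0$ and $f_i$ nonnegative circuit polynomials in $n$ variables; $P_{n,2d}$ is the cone of nonnegative polynomials in $n$ variables of degree at most $2d$. For a proper circuit polynomial $f$, "$f\in\partial C_{n,2d}$" (equivalently $f\in\partial P_{n,2d}$) is understood to mean: $f_{\boldsymbol{\beta}}\in\{\Theta_f,-\Theta_f\}$ if $\boldsymbol{\beta}\notin(2\mathbb{N})^n$, and $f_{\boldsymbol{\beta}}=-\Theta_f$ if $\boldsymbol{\beta}\in(2\mathbb{N})^n$. Zeros are counted without multiplicity. *)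

theory Defs
  imports "HOL-Analysis.Analysis" "HOL-Library.Poly_Mapping"
begin

text \<open>
  Real polynomials in the variables indexed by the finite type \<open>'n\<close>, i.e. the monoid ring of
  \<open>nat ^ 'n\<close> over the reals: a finitely supported map from exponents to coefficients, with the
  convolution product supplied by \<open>Poly_Mapping\<close>. The number of variables is \<open>CARD('n) \<ge> 1\<close>.
\<close>
type_synonym 'n rpoly = "(nat ^ 'n) \<Rightarrow>\<^sub>0 real"

definition peval :: "('n::finite) rpoly \<Rightarrow> real ^ 'n \<Rightarrow> real" where
  "peval p x = (\<Sum>\<gamma>\<in>Poly_Mapping.keys p. Poly_Mapping.lookup p \<gamma> * (\<Prod>i\<in>UNIV. (x $ i) ^ (\<gamma> $ i)))"

definition total_degree :: "('n::finite) rpoly \<Rightarrow> nat" where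
  "total_degree p = Max (insert 0 ((\<lambda>\<gamma>. \<Sum>i\<in>UNIV. \<gamma> $ i) ` Poly_Mapping.keys p))"

definition nonneg_poly :: "('n::finite) rpoly \<Rightarrow> bool" where
  "nonneg_poly p \<longleftrightarrow> (\<forall>x. peval p x \<ge> 0)"

definition even_points :: "(nat ^ 'n::finite) set" where
  "even_points = {\<gamma>. \<forall>i. even (\<gamma> $ i)}"

definition real_point :: "nat ^ 'n::finite \<Rightarrow> real ^ 'n" where
  "real_point \<gamma> = (\<chi> i. real (\<gamma> $ i))"

definition newton_polytope :: "('n::finite) rpoly \<Rightarrow> (real ^ 'n) set" where
  "newton_polytope p = convex hull (real_point ` Poly_Mapping.keys p)"

definition positive_barycentric ::
    "nat \<Rightarrow> (nat \<Rightarrow> nat ^ 'n::finite) \<Rightarrow> nat ^ 'n \<Rightarrow> (nat \<Rightarrow> real) \<Rightarrow> bool" where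
  "positive_barycentric r \<alpha> \<beta> l \<longleftrightarrow>
     (\<forall>j\<le>r. l j > 0) \<and> (\<Sum>j\<le>r. l j) = 1 \<and>
     real_point \<beta> = (\<Sum>j\<le>r. l j *\<^sub>R real_point (\<alpha> j))"

text \<open>
  \<open>f\<close> is a circuit polynomial, presented by its outer exponents \<open>\<alpha> j\<close> with coefficients \<open>a j\<close>
  for \<open>j \<le> r\<close>, its inner exponent \<open>\<beta>\<close> with coefficient \<open>b\<close>, and the barycentric coordinates
  \<open>l j\<close> of \<open>\<beta>\<close>. The values of \<open>\<alpha>\<close>, \<open>a\<close>, \<open>l\<close> at indices above \<open>r\<close> are irrelevant. Injectivity of
  \<open>\<alpha>\<close> on \<open>{..r}\<close> is implied, since an \<open>r\<close>-simplex has \<open>r + 1\<close> extreme points.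
\<close>
definition circuit_presentation ::
    "nat \<Rightarrow> (nat \<Rightarrow> nat ^ 'n::finite) \<Rightarrow> (nat \<Rightarrow> real) \<Rightarrow> nat ^ 'n \<Rightarrow> real \<Rightarrow>
     (nat \<Rightarrow> real) \<Rightarrow> 'n rpoly \<Rightarrow> bool" where
  "circuit_presentation r \<alpha> a \<beta> b l f \<longleftrightarrow>
     r \<le> CARD('n) \<and>
     f = (\<Sum>j\<le>r. Poly_Mapping.single (\<alpha> j) (a j)) + Poly_Mapping.single \<beta> b \<and>
     (\<forall>j\<le>r. a j > 0) \<and>
     int r simplex newton_polytope f \<and>
     {v. v extreme_point_of newton_polytope f} = (\<lambda>j. real_point (\<alpha> j)) ` {..r} \<and>
     (\<forall>j\<le>r. \<alpha> j \<in> even_points) \<and>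
     positive_barycentric r \<alpha> \<beta> l \<and>
     (\<forall>l'. positive_barycentric r \<alpha> \<beta> l' \<longrightarrow> (\<forall>j\<le>r. l' j = l j))"

definition circuit_polynomial :: "('n::finite) rpoly \<Rightarrow> bool" where
  "circuit_polynomial f \<longleftrightarrow> (\<exists>r \<alpha> a \<beta> b l. circuit_presentation r \<alpha> a \<beta> b l f)"

definition circuit_number :: "nat \<Rightarrow> (nat \<Rightarrow> real) \<Rightarrow> (nat \<Rightarrow> real) \<Rightarrow> real" where
  "circuit_number r a l = (\<Prod>j\<le>r. (a j / l j) powr l j)"

definition sum_of_monomial_squares :: "('n::finite) rpoly \<Rightarrow> bool" where
  "sum_of_monomial_squares f \<longleftrightarrow> (\<forall>\<gamma>\<in>Poly_Mapping.keys f. Poly_Mapping.lookup f \<gamma> > 0 \<and> \<gamma> \<in> even_points)"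

definition proper_circuit :: "('n::finite) rpoly \<Rightarrow> bool" where
  "proper_circuit f \<longleftrightarrow> circuit_polynomial f \<and> \<not> sum_of_monomial_squares f"

definition degenerate :: "('n::finite) rpoly \<Rightarrow> bool" where
  "degenerate f \<longleftrightarrow>
     infinite {x. peval f x = 0} \<and> aff_dim (newton_polytope f) \<noteq> int CARD('n)"

text \<open>
  The cone \<open>C\<^bsub>n,2d\<^esub>\<close>; multiplication by \<open>Poly_Mapping.single 0 c\<close> is multiplication by the
  constant \<open>c\<close>.
\<close>
definition sonc_cone :: "nat \<Rightarrow> ('n::finite) rpoly set" where
  "sonc_cone d =
     {p. total_degree p \<le> 2 * d \<and>
         (\<exists>(m::nat) \<mu> g. (\<forall>i<m. \<mu> i \<ge> 0 \<and> circuit_polynomial (g i) \<and> nonneg_poly (g i)) \<and>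
            p = (\<Sum>i<m. Poly_Mapping.single 0 (\<mu> i) * g i))}"

text \<open>
  For a proper circuit polynomial, lying on the boundary of the cone is by convention the stated
  condition on the inner coefficient rather than the topological frontier.
\<close>
definition on_sonc_boundary ::
    "nat \<Rightarrow> nat \<Rightarrow> (nat \<Rightarrow> real) \<Rightarrow> nat ^ 'n::finite \<Rightarrow> real \<Rightarrow> (nat \<Rightarrow> real) \<Rightarrow>
     'n rpoly \<Rightarrow> bool" where
  "on_sonc_boundary d r a \<beta> b l f \<longleftrightarrow>
     f \<in> sonc_cone d \<and>
     (if \<beta> \<in> even_points then b = - circuit_number r a l
      else b \<in> {circuit_number r a l, - circuit_number r a l})"

definition torus_zeros :: "('n::finite) rpoly \<Rightarrow> (real ^ 'n) set" where
  "torus_zeros f = {x. (\<forall>i. x $ i \<noteq> 0) \<and> peval f x = 0}"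

end

theory Submission
  imports Defs
begin

text \<open>
  Write a point of the torus as \<open>x\<^sub>i = \<plusminus>exp w\<^sub>i\<close>. With \<open>E\<^sub>j = ln (a\<^sub>j / \<lambda>\<^sub>j) + \<langle>\<alpha>(j), w\<rangle>\<close> and
  \<open>b = \<plusminus>\<Theta>\<close> one has \<open>f x = (\<Sum>j. \<lambda>\<^sub>j exp E\<^sub>j) \<plusminus> exp (\<Sum>j. \<lambda>\<^sub>j E\<^sub>j)\<close>, so by the equality case of
  Jensen's inequality \<open>x\<close> is a zero iff \<open>b x\<^sup>\<beta> < 0\<close> and all \<open>E\<^sub>j\<close> agree. As the \<open>\<alpha>(j)\<close> are
  affinely independent, the latter is a consistent linear system in \<open>w\<close> of rank \<open>r\<close>. If \<open>r < n\<close>, it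
  has infinitely many solutions and \<open>f\<close> is degenerate. If \<open>r = n\<close>, the solution is unique, and the
  zeros correspond to the sign patterns with \<open>b x\<^sup>\<beta> < 0\<close>: all of them if \<open>\<beta>\<close> is even, and
  half of them otherwise, since flipping a coordinate in which \<open>\<beta>\<close> is odd flips the sign.
\<close>

section \<open>Coordinates on the real torus: an orthant and logarithms of absolute values\<close>

definition signed_exp :: "'n::finite set \<Rightarrow> real ^ 'n \<Rightarrow> real ^ 'n" where
  "signed_exp A w = (\<chi> i. (if i \<in> A then -1 else 1) * exp (w $ i))"

text \<open>The sign of the monomial with exponent \<open>\<gamma>\<close> on the orthant whose
  negative coordinates are those in \<open>A\<close>.\<close>

definition monomial_sign :: "nat ^ 'n::finite \<Rightarrow> 'n set \<Rightarrow> real" where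
  "monomial_sign \<gamma> A = (\<Prod>i\<in>UNIV. (if i \<in> A then -1 else 1) ^ (\<gamma> $ i))"

lemma signed_exp_nonzero: "signed_exp A w $ i \<noteq> 0"
  by (simp add: signed_exp_def)

lemma signed_exp_eq_iff: "signed_exp A w = signed_exp B v \<longleftrightarrow> A = B \<and> w = v"
proof
  assume eq: "signed_exp A w = signed_exp B v"
  have "(i \<in> A \<longleftrightarrow> i \<in> B) \<and> w $ i = v $ i" for i
  proof -
    have "signed_exp A w $ i = signed_exp B v $ i" using eq by simp
    then show ?thesis
      using exp_gt_zero[of "w $ i"] exp_gt_zero[of "v $ i"]
      by (auto simp: signed_exp_def split: if_splits; linarith)
  qed
  then show "A = B \<and> w = v" by (auto simp: vec_eq_iff)
qed simp

lemma signed_exp_surj: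
  assumes "\<And>i. x $ i \<noteq> 0"
  obtains A w where "x = signed_exp A w"
proof
  show "x = signed_exp {i. x $ i < 0} (\<chi> i. ln \<bar>x $ i\<bar>)"
    using assms by (auto simp: signed_exp_def vec_eq_iff)
qed

lemma monomial_signed_exp:
  "(\<Prod>i\<in>UNIV. (signed_exp A w $ i) ^ (\<gamma> $ i)) = monomial_sign \<gamma> A * exp (real_point \<gamma> \<bullet> w)"
  by (simp add: signed_exp_def monomial_sign_def power_mult_distrib prod.distrib inner_vec_def
      real_point_def exp_sum exp_of_nat_mult)

lemma monomial_sign_even: "\<gamma> \<in> even_points \<Longrightarrow> monomial_sign \<gamma> A = 1"
  by (auto simp: monomial_sign_def even_points_def intro!: prod.neutral)

lemma monomial_sign_cases: "monomial_sign \<gamma> A = 1 \<or> monomial_sign \<gamma> A = -1"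
proof -
  have "\<bar>monomial_sign \<gamma> A\<bar> = 1"
    by (auto simp: monomial_sign_def abs_prod power_abs intro!: prod.neutral)
  then show ?thesis by linarith
qed

section \<open>Counting sign patterns\<close>

definition flip :: "'n \<Rightarrow> 'n set \<Rightarrow> 'n set" where
  "flip k A = (if k \<in> A then A - {k} else insert k A)"

lemma flip_flip: "flip k (flip k A) = A"
  by (auto simp: flip_def)

lemma monomial_sign_flip:
  assumes "odd (\<gamma> $ k)"
  shows "monomial_sign \<gamma> (flip k A) = - monomial_sign \<gamma> A"
proof -
  let ?e = "\<lambda>A i. (if i \<in> A then -1 else 1 :: real) ^ (\<gamma> $ i)"
  have "(\<Prod>i\<in>UNIV - {k}. ?e (flip k A) i) = (\<Prod>i\<in>UNIV - {k}. ?e A i)"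
    by (intro prod.cong) (auto simp: flip_def)
  moreover have "?e (flip k A) k = - ?e A k"
    using assms by (auto simp: flip_def)
  ultimately show ?thesis
    unfolding monomial_sign_def by (simp add: prod.remove[of UNIV k])
qed

lemma card_monomial_sign:
  fixes \<gamma> :: "nat ^ 'n::finite"
  assumes "\<gamma> \<notin> even_points" "s = 1 \<or> s = -1"
  shows "card {A. monomial_sign \<gamma> A = s} = 2 ^ (CARD('n) - 1)"
proof -
  obtain k where k: "odd (\<gamma> $ k)" using assms(1) by (auto simp: even_points_def)
  let ?S = "\<lambda>s. {A. monomial_sign \<gamma> A = s}"
  have "bij_betw (flip k) (?S s) (?S (-s))"
    by (rule bij_betw_byWitness[where f' = "flip k"])
      (auto simp: flip_flip monomial_sign_flip[of \<gamma> k, OF k])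
  then have eq: "card (?S s) = card (?S (-s))" by (rule bij_betw_same_card)
  have "?S s \<union> ?S (-s) = Pow UNIV"
    using assms(2) monomial_sign_cases[of \<gamma>] by fastforce
  moreover have "card (?S s \<union> ?S (-s)) = card (?S s) + card (?S (-s))"
    using assms(2) by (intro card_Un_disjoint) auto
  ultimately have "2 * card (?S s) = 2 ^ CARD('n)"
    using eq by (simp add: card_Pow)
  \<comment> \<open>The truncated subtraction is harmless: \<open>CARD('n)\<close> is
    positive.\<close>
  also have "\<dots> = 2 * 2 ^ (CARD('n) - 1)"
    by (simp add: power_eq_if[of 2 "CARD('n)"])
  finally show ?thesis by simp
qed

section \<open>Evaluation of polynomials\<close>

lemma peval_superset:
  assumes "finite K" "Poly_Mapping.keys p \<subseteq> K"
  shows "peval p x = (\<Sum>\<gamma>\<in>K. Poly_Mapping.lookup p \<gamma> * (\<Prod>i\<in>UNIV. (x $ i) ^ (\<gamma> $ i)))"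
  unfolding peval_def
  using assms by (intro sum.mono_neutral_left) (auto simp: in_keys_iff)

lemma peval_add: "peval (p + q) x = peval p x + peval q x"
proof -
  \<comment> \<open>Terms may cancel in \<open>p + q\<close>, so all three polynomials are evaluated
    over one common finite set of exponents.\<close>
  let ?K = "Poly_Mapping.keys p \<union> Poly_Mapping.keys q"
  show ?thesis
    using Poly_Mapping.keys_add[of p q]
    by (simp add: peval_superset[of ?K] lookup_add distrib_right sum.distrib)
qed

lemma peval_single: "peval (Poly_Mapping.single \<gamma> c) x = c * (\<Prod>i\<in>UNIV. (x $ i) ^ (\<gamma> $ i))"
  by (simp add: peval_superset[of "{\<gamma>}"])

lemma peval_sum: "peval (\<Sum>j\<in>J. p j) x = (\<Sum>j\<in>J. peval (p j) x)"
proof (induction J rule: infinite_finite_induct)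
  case (insert j J)
  then show ?case by (simp add: peval_add)
qed (simp_all add: peval_def)

section \<open>Equality in Jensen's inequality and the criterion for zeros\<close>

lemma jensen_exp_eq_iff:
  fixes l E :: "nat \<Rightarrow> real"
  assumes "\<forall>j\<le>r. l j > 0" "(\<Sum>j\<le>r. l j) = 1"
  shows "(\<Sum>j\<le>r. l j * exp (E j)) = exp (\<Sum>j\<le>r. l j * E j) \<longleftrightarrow> (\<exists>m. \<forall>j\<le>r. E j = m)"
proof
  define m where "m = (\<Sum>j\<le>r. l j * E j)"
  assume "(\<Sum>j\<le>r. l j * exp (E j)) = exp (\<Sum>j\<le>r. l j * E j)"
  then have *: "(\<Sum>j\<le>r. l j * exp (E j)) = exp m" by (simp add: m_def)
  \<comment> \<open>The weighted gaps in \<open>1 + t \<le> exp t\<close> at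
    \<open>t = E j - m\<close>, where \<open>m\<close> is the weighted mean. They are nonnegative
    and, under equality in Jensen, sum to 0, so each vanishes.\<close>
  define g where "g j = l j * (exp (E j - m) - 1 - (E j - m))" for j
  have "g j = l j * exp (E j) / exp m - l j - l j * E j + m * l j" for j
    by (simp add: g_def exp_diff algebra_simps)
  then have "(\<Sum>j\<le>r. g j) = (\<Sum>j\<le>r. l j * exp (E j)) / exp m - (\<Sum>j\<le>r. l j) - m + m * (\<Sum>j\<le>r. l j)"
    by (simp add: sum.distrib sum_subtractf m_def[symmetric]
        flip: sum_distrib_left sum_divide_distrib)
  then have "(\<Sum>j\<le>r. g j) = 0" by (simp add: * assms(2))
  moreover have "\<forall>j\<in>{..r}. g j \<ge> 0"
  proof
    fix j assume "j \<in> {..r}"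
    then show "g j \<ge> 0"
      using assms(1) exp_ge_add_one_self[of "E j - m"] unfolding g_def
      by (intro mult_nonneg_nonneg) (simp add: less_imp_le, linarith)
  qed
  ultimately have g0: "g j = 0" if "j \<le> r" for j
    using that sum_nonneg_eq_0_iff[of "{..r}" g] by auto
  have "E j = m" if "j \<le> r" for j
  proof -
    have "l j \<noteq> 0" using assms(1) that by force
    then have "exp (E j - m) - 1 - (E j - m) = 0" using g0[OF that] by (simp add: g_def)
    \<comment> \<open>Equality in \<open>ln x \<le> x - 1\<close> forces
      \<open>x = 1\<close>.\<close>
    then have "ln (exp (E j - m)) = exp (E j - m) - 1" by simp
    then have "exp (E j - m) = 1" by (intro ln_eq_minus_one) simp_all
    then show ?thesis by simp
  qed
  then show "\<exists>m. \<forall>j\<le>r. E j = m" by blast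
next
  assume "\<exists>m. \<forall>j\<le>r. E j = m"
  then obtain m where "\<And>j. j \<le> r \<Longrightarrow> E j = m" by blast
  then show "(\<Sum>j\<le>r. l j * exp (E j)) = exp (\<Sum>j\<le>r. l j * E j)"
    by (simp add: sum_distrib_right[symmetric] assms(2))
qed

lemma circuit_number_pos:
  assumes "\<forall>j\<le>r. a j > 0" "\<forall>j\<le>r. l j > 0"
  shows "circuit_number r a l > 0"
  using assms unfolding circuit_number_def by (force intro!: prod_pos)

text \<open>The weights in \<Theta> are the barycentric coordinates of \<beta>. Hence \<Theta> times
  the monomial at \<beta> is the weighted geometric mean of the outer terms divided by their
  weights, which is the exponential side of Jensen's inequality.\<close>

lemma circuit_number_times_exp:
  assumes "\<forall>j\<le>r. a j > 0" "positive_barycentric r \<alpha> \<beta> l"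
  shows "circuit_number r a l * exp (real_point \<beta> \<bullet> w) =
    exp (\<Sum>j\<le>r. l j * (ln (a j / l j) + real_point (\<alpha> j) \<bullet> w))"
proof -
  have l: "\<forall>j\<le>r. l j > 0" and bary: "real_point \<beta> = (\<Sum>j\<le>r. l j *\<^sub>R real_point (\<alpha> j))"
    using assms(2) by (auto simp: positive_barycentric_def)
  have "circuit_number r a l = (\<Prod>j\<le>r. exp (l j * ln (a j / l j)))"
    unfolding circuit_number_def
  proof (intro prod.cong refl)
    fix j assume "j \<in> {..r}"
    then have "a j > 0" "l j > 0" using assms(1) l by auto
    then show "(a j / l j) powr l j = exp (l j * ln (a j / l j))" by (simp add: powr_def)
  qed
  also have "\<dots> = exp (\<Sum>j\<le>r. l j * ln (a j / l j))" by (simp add: exp_sum)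
  finally show ?thesis
    by (simp add: bary inner_sum_left exp_add[symmetric] sum.distrib[symmetric] distrib_left)
qed

lemma peval_circuit_eq_0_iff:
  assumes pres: "circuit_presentation r \<alpha> a \<beta> b l f"
    and b: "\<bar>b\<bar> = circuit_number r a l"
  shows "peval f (signed_exp A w) = 0 \<longleftrightarrow>
    monomial_sign \<beta> A = - sgn b \<and> (\<exists>m. \<forall>j\<le>r. ln (a j / l j) + real_point (\<alpha> j) \<bullet> w = m)"
proof -
  have f: "f = (\<Sum>j\<le>r. Poly_Mapping.single (\<alpha> j) (a j)) + Poly_Mapping.single \<beta> b"
    and a: "\<forall>j\<le>r. a j > 0" and ev: "\<forall>j\<le>r. \<alpha> j \<in> even_points"
    and bary: "positive_barycentric r \<alpha> \<beta> l"
    using pres by (auto simp: circuit_presentation_def)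
  have l: "\<forall>j\<le>r. l j > 0" and l1: "(\<Sum>j\<le>r. l j) = 1"
    using bary by (auto simp: positive_barycentric_def)
  define E where "E j = ln (a j / l j) + real_point (\<alpha> j) \<bullet> w" for j
  have outer: "a j * exp (real_point (\<alpha> j) \<bullet> w) = l j * exp (E j)" if "j \<le> r" for j
  proof -
    have "a j > 0" "l j > 0" using a l that by auto
    then show ?thesis by (simp add: E_def exp_add)
  qed
  let ?s = "sgn b * monomial_sign \<beta> A"
  \<comment> \<open>Splitting off \<open>sgn b\<close> leaves \<open>\<bar>b\<bar>\<close>, which is
    the circuit number, for either sign of \<open>b\<close>.\<close>
  have "b * monomial_sign \<beta> A * exp (real_point \<beta> \<bullet> w) = ?s * (\<bar>b\<bar> * exp (real_point \<beta> \<bullet> w))"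
    by (metis (no_types, opaque_lifting) abs_sgn mult.assoc mult.commute mult_sgn_abs)
  also have "\<dots> = ?s * exp (\<Sum>j\<le>r. l j * E j)"
    unfolding b E_def by (simp only: circuit_number_times_exp[OF a bary])
  finally have inner: "b * monomial_sign \<beta> A * exp (real_point \<beta> \<bullet> w) = ?s * exp (\<Sum>j\<le>r. l j * E j)" .
  have "peval f (signed_exp A w) =
      (\<Sum>j\<le>r. l j * exp (E j)) + b * monomial_sign \<beta> A * exp (real_point \<beta> \<bullet> w)"
    using ev by (simp add: f peval_add peval_sum peval_single monomial_signed_exp
        monomial_sign_even outer)
  then have val: "peval f (signed_exp A w) = (\<Sum>j\<le>r. l j * exp (E j)) + ?s * exp (\<Sum>j\<le>r. l j * E j)"
    by (simp only: inner)
  have pos: "(\<Sum>j\<le>r. l j * exp (E j)) > 0" using l by (intro sum_pos) auto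
  have "b \<noteq> 0" using b circuit_number_pos[OF a l] by auto
  \<comment> \<open>\<open>?s\<close> is the sign of the inner term: if positive, the value of
    \<open>f\<close> is positive; if negative, that value is the difference of the two sides of
    Jensen's inequality.\<close>
  then have "?s = 1 \<and> monomial_sign \<beta> A \<noteq> - sgn b \<or> ?s = -1 \<and> monomial_sign \<beta> A = - sgn b"
    using monomial_sign_cases[of \<beta> A] by (cases "b > 0") auto
  then show ?thesis
  proof
    assume s: "?s = 1 \<and> monomial_sign \<beta> A \<noteq> - sgn b"
    then have "peval f (signed_exp A w) > 0"
      unfolding val using pos by (simp add: add_pos_pos)
    then show ?thesis using s by simp
  next
    assume s: "?s = -1 \<and> monomial_sign \<beta> A = - sgn b"
    then have "peval f (signed_exp A w) = 0 \<longleftrightarrow> (\<exists>m. \<forall>j\<le>r. E j = m)"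
      using jensen_exp_eq_iff[OF l l1, of E] unfolding val by auto
    then show ?thesis using s by (simp add: E_def)
  qed
qed

section \<open>The linear system for the logarithmic coordinates\<close>

lemma independent_inner_solvable:
  fixes S :: "'a::euclidean_space set"
  assumes "independent S"
  shows "\<exists>w. \<forall>v\<in>S. v \<bullet> w = c v"
proof -
  obtain g :: "'a \<Rightarrow> real" where g: "linear g" "\<forall>v\<in>S. g v = c v"
    using linear_independent_extend[OF assms] by blast
  \<comment> \<open>\<open>adjoint g 1\<close> is the Riesz vector representing the functional
    \<open>g\<close>.\<close>
  have "v \<bullet> adjoint g 1 = g v" for v
    using adjoint_works[OF g(1), of v 1] by simp
  with g(2) show ?thesis by (intro exI[of _ "adjoint g 1"]) simp
qed

lemma circuit_simplex:
  assumes "circuit_presentation r \<alpha> a \<beta> b l f"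
  defines "p \<equiv> \<lambda>j. real_point (\<alpha> j)"
  shows "inj_on p {..r}" "\<not> affine_dependent (p ` {..r})" "aff_dim (newton_polytope f) = int r"
proof -
  have sim: "int r simplex newton_polytope f"
    and ext: "{v. v extreme_point_of newton_polytope f} = p ` {..r}"
    using assms(1) by (auto simp: circuit_presentation_def p_def)
  then obtain C where C: "\<not> affine_dependent C" "int (card C) = int r + 1"
      "newton_polytope f = convex hull C"
    unfolding simplex_def by blast
  \<comment> \<open>Affinely independent points are exactly the extreme points of their hull.
    Counting \<open>r + 1\<close> of them then gives injectivity.\<close>
  have "C = p ` {..r}"
    using ext C by (auto simp: extreme_point_of_convex_hull_affine_independent)
  with C show "\<not> affine_dependent (p ` {..r})" "inj_on p {..r}"
    by (auto intro: eq_card_imp_inj_on)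
  show "aff_dim (newton_polytope f) = int r"
    using sim aff_dim_simplex by blast
qed

text \<open>Subtracting the equation at index 0 eliminates \<open>m\<close> and leaves
  \<open>r\<close> equations with independent normals. The solutions form a translate of the
  orthogonal complement of their span, which is trivial exactly when
  \<open>r = CARD('n)\<close>.\<close>

lemma circuit_system:
  fixes \<alpha> :: "nat \<Rightarrow> nat ^ 'n::finite" and c :: "nat \<Rightarrow> real"
  assumes "circuit_presentation r \<alpha> a \<beta> b l f"
  defines "W \<equiv> {w. \<exists>m. \<forall>j\<le>r. c j + real_point (\<alpha> j) \<bullet> w = m}"
  shows "r = CARD('n) \<Longrightarrow> \<exists>w. W = {w}" and "r < CARD('n) \<Longrightarrow> infinite W"
proof -
  define p where "p = (\<lambda>j. real_point (\<alpha> j))"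
  \<comment> \<open>Edge vectors of the simplex at the vertex \<open>p 0\<close>, written in the
    form that \<open>affine_dependent_iff_dependent\<close> produces.\<close>
  define v where "v j = - p 0 + p j" for j
  have inj: "inj_on p {..r}" and indep: "\<not> affine_dependent (p ` {..r})"
    using circuit_simplex[OF assms(1)] by (simp_all add: p_def)
  define S where "S = v ` {1..r}"
  have injv: "inj_on v {1..r}"
    using inj by (auto simp: inj_on_def v_def)
  then have card_S: "card S = r" by (simp add: S_def card_image)
  have "{..r} = insert 0 {1..r}" by auto
  then have im: "p ` {..r} = insert (p 0) (p ` {1..r})" by simp
  have "p 0 \<notin> p ` {1..r}" using inj by (force simp: inj_on_def)
  then have ind: "independent S"
    using indep unfolding im by (simp add: affine_dependent_iff_dependent S_def v_def image_image)
  have W: "w \<in> W \<longleftrightarrow> (\<forall>j\<in>{1..r}. v j \<bullet> w = c 0 - c j)" for w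
  proof
    assume "w \<in> W"
    then obtain m where "\<forall>j\<le>r. c j + p j \<bullet> w = m" by (auto simp: W_def p_def)
    then have eq: "c j + p j \<bullet> w = c 0 + p 0 \<bullet> w" if "j \<le> r" for j using that by simp
    show "\<forall>j\<in>{1..r}. v j \<bullet> w = c 0 - c j"
    proof
      fix j assume "j \<in> {1..r}"
      then show "v j \<bullet> w = c 0 - c j" using eq[of j] by (simp add: v_def inner_diff_left)
    qed
  next
    assume *: "\<forall>j\<in>{1..r}. v j \<bullet> w = c 0 - c j"
    have "c j + p j \<bullet> w = c 0 + p 0 \<bullet> w" if "j \<le> r" for j
    proof (cases "j = 0")
      case False
      then have "v j \<bullet> w = c 0 - c j" using * that by simp
      then show ?thesis by (simp add: v_def inner_diff_left)
    qed simp
    then show "w \<in> W" unfolding W_def p_def by blast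
  qed
  \<comment> \<open>Right-hand sides depend on the index, whereas solvability is stated for
    functions of the vector; injectivity of \<open>v\<close> recovers the index.\<close>
  have inv: "inv_into {1..r} v (v j) = j" if "j \<in> {1..r}" for j
    using injv that by (rule inv_into_f_f)
  obtain w0 where "\<forall>x\<in>S. x \<bullet> w0 = c 0 - c (inv_into {1..r} v x)"
    using independent_inner_solvable[OF ind, of "\<lambda>x. c 0 - c (inv_into {1..r} v x)"] by blast
  then have w0: "\<forall>j\<in>{1..r}. v j \<bullet> w0 = c 0 - c j"
    using inv by (simp add: S_def)
  {
    assume "r = CARD('n)"
    then have span: "span S = UNIV"
      using ind card_S card_eq_dim[of S UNIV] independent_imp_finite[OF ind]
      by (auto simp: dim_UNIV)
    have "w = w0" if "w \<in> W" for w
    proof -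
      have "x \<bullet> (w - w0) = 0" if "x \<in> S" for x
        using that \<open>w \<in> W\<close> w0 unfolding W by (auto simp: S_def inner_diff_right)
      then have "orthogonal (w - w0) x" if "x \<in> S" for x
        using that by (simp add: orthogonal_def inner_commute)
      then have "orthogonal (w - w0) (w - w0)"
        using orthogonal_to_span[of "w - w0" S] span by auto
      then show ?thesis by (simp add: orthogonal_self)
    qed
    then show "\<exists>w. W = {w}" using w0 W by blast
  }
  {
    assume "r < CARD('n)"
    then have "dim S < DIM(real ^ 'n)"
      using ind card_S by (simp add: dim_eq_card_independent)
    \<comment> \<open>Moving from \<open>w0\<close> along a direction \<open>z\<close> orthogonal to
      all edges stays in \<open>W\<close>, so \<open>W\<close> contains a line.\<close>
    then obtain z where z: "z \<noteq> 0" "\<And>y. y \<in> span S \<Longrightarrow> orthogonal z y"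
      using orthogonal_to_subspace_exists by blast
    have "v j \<bullet> z = 0" if "j \<in> {1..r}" for j
      using z(2)[of "v j"] that by (simp add: S_def span_base orthogonal_def inner_commute)
    then have "range (\<lambda>t. w0 + t *\<^sub>R z) \<subseteq> W"
      using w0 by (auto simp: W inner_add_right)
    moreover have "infinite (range (\<lambda>t::real. w0 + t *\<^sub>R z))"
      using z(1) by (subst finite_image_iff) (auto simp: inj_on_def infinite_UNIV_char_0)
    ultimately show "infinite W" using finite_subset by blast
  }
qed

section \<open>Counting the zeros, one in each admissible orthant\<close>

theorem theorem4p3:
  fixes f :: "('n::finite) rpoly"
    and d r :: nat
    and \<alpha> :: "nat \<Rightarrow> nat ^ 'n"
    and a l :: "nat \<Rightarrow> real"
    and \<beta> :: "nat ^ 'n"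
    and b :: real
  assumes "d \<ge> 1"
    and "circuit_presentation r \<alpha> a \<beta> b l f"
    and "proper_circuit f"
    and "\<not> degenerate f"
    and "nonneg_poly f"
    and "on_sonc_boundary d r a \<beta> b l f"
  shows "(\<beta> \<in> even_points \<longrightarrow> card (torus_zeros f) = 2 ^ CARD('n)) \<and>
         (\<beta> \<notin> even_points \<longrightarrow> card (torus_zeros f) = 2 ^ (CARD('n) - 1))"
proof -
  note pres = assms(2)
  have "\<forall>j\<le>r. a j > 0" "\<forall>j\<le>r. l j > 0" "r \<le> CARD('n)"
    using pres by (auto simp: circuit_presentation_def positive_barycentric_def)
  then have pos: "circuit_number r a l > 0" by (simp add: circuit_number_pos)
  have b: "\<bar>b\<bar> = circuit_number r a l" and b_even: "\<beta> \<in> even_points \<Longrightarrow> sgn b = -1"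
    and b_sgn: "- sgn b = 1 \<or> - sgn b = -1"
    using assms(6) pos by (auto simp: on_sonc_boundary_def split: if_splits)
  define W where "W = {w. \<exists>m. \<forall>j\<le>r. ln (a j / l j) + real_point (\<alpha> j) \<bullet> w = m}"
  define \<S> where "\<S> = {A. monomial_sign \<beta> A = - sgn b}"
  have zero_iff: "peval f (signed_exp A w) = 0 \<longleftrightarrow> A \<in> \<S> \<and> w \<in> W" for A w
    using peval_circuit_eq_0_iff[OF pres b] by (simp add: W_def \<S>_def)
  have card_\<S>: "card \<S> = (if \<beta> \<in> even_points then 2 ^ CARD('n) else 2 ^ (CARD('n) - 1))"
  proof (cases "\<beta> \<in> even_points")
    case True
    then have "\<S> = Pow UNIV" using b_even by (auto simp: \<S>_def monomial_sign_even)
    then show ?thesis using True by (simp add: card_Pow)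
  next
    case False
    then show ?thesis using card_monomial_sign[OF False b_sgn] by (simp add: \<S>_def)
  qed
  \<comment> \<open>Nondegeneracy enters here: if \<open>r\<close> were smaller, one admissible
    orthant would already contain infinitely many zeros, while the Newton polytope has dimension
    \<open>r\<close>.\<close>
  have "r = CARD('n)"
  proof (rule ccontr)
    assume "r \<noteq> CARD('n)"
    with \<open>r \<le> CARD('n)\<close> have less: "r < CARD('n)" by simp
    then have "infinite W" unfolding W_def by (rule circuit_system(2)[OF pres])
    \<comment> \<open>An infinite \<open>W\<close> yields zeros only if some sign pattern is
      admissible.\<close>
    moreover have "card \<S> \<noteq> 0" by (simp add: card_\<S>)
    then obtain A where "A \<in> \<S>" by (metis card.empty all_not_in_conv)
    then have "signed_exp A ` W \<subseteq> {x. peval f x = 0}" by (auto simp: zero_iff)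
    moreover have "inj_on (signed_exp A) W" by (simp add: inj_on_def signed_exp_eq_iff)
    ultimately have "infinite {x. peval f x = 0}"
      by (meson finite_imageD finite_subset)
    moreover have "aff_dim (newton_polytope f) \<noteq> int CARD('n)"
      using less circuit_simplex(3)[OF pres] by simp
    ultimately show False using assms(4) by (simp add: degenerate_def)
  qed
  then have "\<exists>w. W = {w}" unfolding W_def by (rule circuit_system(1)[OF pres])
  then obtain w where w: "W = {w}" by blast
  have "torus_zeros f = (\<lambda>A. signed_exp A w) ` \<S>"
  proof (intro equalityI subsetI)
    fix x assume x: "x \<in> torus_zeros f"
    then obtain A v where "x = signed_exp A v"
      using signed_exp_surj[of x] by (auto simp: torus_zeros_def)
    with x show "x \<in> (\<lambda>A. signed_exp A w) ` \<S>"
      by (auto simp: torus_zeros_def zero_iff w)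
  next
    fix x assume "x \<in> (\<lambda>A. signed_exp A w) ` \<S>"
    then show "x \<in> torus_zeros f"
      by (auto simp: torus_zeros_def zero_iff w signed_exp_nonzero)
  qed
  moreover have "inj_on (\<lambda>A. signed_exp A w) \<S>" by (simp add: inj_on_def signed_exp_eq_iff)
  ultimately show ?thesis using card_\<S> by (simp add: card_image)
qed

end
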